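(* Let $\Phi=(\phi_j)_{1\le j\le N}$ be a sequence of nonzero elements of a real vector space $F$, generating $F$ and spanning a salient cone $\mathfrak c(\Phi)$, and let $\tau\subset\mathfrak c(\Phi)$ be a $\Phi$-tope. Let $X(\Phi,\tau)$ be the Combinatorial Brianchon-Gram function. For any linear form $\beta$ on $\mathbb R^N$ which is regular with respect to $\Phi$, let $Y(\Phi,\tau,\beta)$ be the Combinatorial Lawrence-Varchenko function. Then $$Y(\Phi,\tau,\beta)=X(\Phi,\tau)$$ as elements of $\mathbb Q[p_1,\dots,p_N,q_1,\dots,q_N]$.
   Context: $F$ is finite dimensional, $r=\dim F$; $\mathfrak c(\Phi)=\{\sum_i t_i\phi_i:t_i\ge 0\}$; a cone is salient if it contains no affine line. A $\Phi$-wall is a hyperplane of $F$ spanned by $r-1$ linearly independent elements of $\Phi$; a $\Phi$-tope is a connected component of the complement in $F$ of the union of all $\Phi$-walls. $I^c$ denotes the complement of $I$ in $\{1,\dots,N\}$. $\mathcal G(\Phi,\tau)$ (resp. $\mathcal B(\Phi,\tau)$) is the set of $I\subseteq\{1,\dots,N\}$ such that $(\phi_i)_{i\in I}$ generates $F$ (resp. is a basis of $F$) and $\tau$ is contained in the cone generated by $\{\phi_i,i\in I\}$. $\mathcal B(\Phi)$ is the set of all $I$ such that $(\phi_i)_{i\in I}$ is a basis of $F$. The Combinatorial Brianchon-Gram function is $$X(\Phi,\tau)=\sum_{I\in\mathcal G(\Phi,\tau)}(-1)^{|I|-\dim F}\prod_{i\in I^c}p_i\prod_{i\in I}(p_i+q_i).$$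 Let $(e_i)$ be the standard basis of $\mathbb R^N$ and $V=\{x\in\mathbb R^N:\sum_i x_i\phi_i=0\}$. For $K\in\mathcal B(\Phi)$ one has $\mathbb R^N=V\oplus\bigoplus_{i\in K}\mathbb R e_i$, and $\rho_{\Phi,K}:\mathbb R^N\to V$ denotes the corresponding projection. A linear form $\beta$ on $\mathbb R^N$ is regular with respect to $\Phi$ if $\langle\beta,\rho_{\Phi,K}(e_j)\rangle\ne 0$ for all $K\in\mathcal B(\Phi)$ and $j\in K^c$. For such $\beta$, let ${K^c_\beta}^+$ (resp. ${K^c_\beta}^-$) be the set of $j\in K^c$ with $\langle\beta,\rho_{\Phi,K}(e_j)\rangle>0$ (resp. $<0$). The Combinatorial Lawrence-Varchenko function is $$Y(\Phi,\tau,\beta)=\sum_{K\in\mathcal B(\Phi,\tau)}(-1)^{|{K^c_\beta}^-|}\prod_{i\in{K^c_\beta}^+}p_i\prod_{i\in{K^c_\beta}^-}q_i\prod_{i\in K}(p_i+q_i).$$ *)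

theory Defs
  imports "HOL-Analysis.Analysis" "HOL-Library.Poly_Mapping"
begin

text \<open>The index set \<open>{1,\<dots>,N}\<close> is a finite type \<open>'n\<close>, and the vector space \<open>F\<close> is a Euclidean
  space \<open>'a\<close>. Its inner product is used only through the topology it induces, which is the
  canonical topology of a finite-dimensional real vector space.\<close>

definition generated_cone :: "('n \<Rightarrow> 'a::real_vector) \<Rightarrow> 'n set \<Rightarrow> 'a set" where
  "generated_cone \<phi> I = {(\<Sum>i\<in>I. t i *\<^sub>R \<phi> i) |t. \<forall>i\<in>I. 0 \<le> t i}"

definition salient :: "'a::real_vector set \<Rightarrow> bool" where
  "salient C \<longleftrightarrow> \<not> (\<exists>x v. v \<noteq> 0 \<and> range (\<lambda>t::real. x + t *\<^sub>R v) \<subseteq> C)"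

definition walls :: "('n \<Rightarrow> 'a::euclidean_space) \<Rightarrow> 'a set set" where
  "walls \<phi> = {span S |S. S \<subseteq> range \<phi> \<and> independent S \<and> card S = DIM('a) - 1}"

definition topes :: "('n \<Rightarrow> 'a::euclidean_space) \<Rightarrow> 'a set set" where
  "topes \<phi> = components (- \<Union> (walls \<phi>))"

definition generating_sets :: "('n \<Rightarrow> 'a::real_vector) \<Rightarrow> 'n set set" where
  "generating_sets \<phi> = {I. span (\<phi> ` I) = UNIV}"

text \<open>Injectivity on \<open>K\<close> is needed because \<open>\<phi>\<close> may repeat vectors: the family indexed by \<open>K\<close>,
  not just its set of values, has to be a basis.\<close>

definition basis_sets :: "('n \<Rightarrow> 'a::real_vector) \<Rightarrow> 'n set set" where
  "basis_sets \<phi> = {K. inj_on \<phi> K \<and> independent (\<phi> ` K) \<and> span (\<phi> ` K) = UNIV}"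

definition generating_sets_at :: "('n \<Rightarrow> 'a::real_vector) \<Rightarrow> 'a set \<Rightarrow> 'n set set" where
  "generating_sets_at \<phi> \<tau> = {I \<in> generating_sets \<phi>. \<tau> \<subseteq> generated_cone \<phi> I}"

definition basis_sets_at :: "('n \<Rightarrow> 'a::real_vector) \<Rightarrow> 'a set \<Rightarrow> 'n set set" where
  "basis_sets_at \<phi> \<tau> = {K \<in> basis_sets \<phi>. \<tau> \<subseteq> generated_cone \<phi> K}"

text \<open>The polynomial ring in the variables \<open>p\<^sub>i, q\<^sub>i\<close> over the rationals is the monoid algebra of
  finitely supported exponent vectors.\<close>

datatype 'n pq_var = Var_p 'n | Var_q 'n

type_synonym 'n pq_poly = "('n pq_var \<Rightarrow>\<^sub>0 nat) \<Rightarrow>\<^sub>0 rat"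

definition pvar :: "'n \<Rightarrow> 'n pq_poly" where
  "pvar i = Poly_Mapping.single (Poly_Mapping.single (Var_p i) 1) 1"

definition qvar :: "'n \<Rightarrow> 'n pq_poly" where
  "qvar i = Poly_Mapping.single (Poly_Mapping.single (Var_q i) 1) 1"

text \<open>The natural-number subtraction in the exponent is exact, since a generating family has at
  least \<open>DIM('a)\<close> members.\<close>

definition brianchon_gram :: "('n::finite \<Rightarrow> 'a::euclidean_space) \<Rightarrow> 'a set \<Rightarrow> 'n pq_poly" where
  "brianchon_gram \<phi> \<tau> =
     (\<Sum>I\<in>generating_sets_at \<phi> \<tau>.
        (-1) ^ (card I - DIM('a)) * (\<Prod>i\<in>- I. pvar i) * (\<Prod>i\<in>I. pvar i + qvar i))"

definition relations :: "('n::finite \<Rightarrow> 'a::real_vector) \<Rightarrow> (real ^ 'n) set" where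
  "relations \<phi> = {x. (\<Sum>i\<in>UNIV. x $ i *\<^sub>R \<phi> i) = 0}"

definition rho :: "('n::finite \<Rightarrow> 'a::real_vector) \<Rightarrow> 'n set \<Rightarrow> real ^ 'n \<Rightarrow> real ^ 'n" where
  "rho \<phi> K x = (THE v. v \<in> relations \<phi> \<and> x - v \<in> span ((\<lambda>i. axis i 1) ` K))"

lemma ex1_rho:
  fixes \<phi> :: "'n::finite \<Rightarrow> 'a::real_vector"
  assumes K: "K \<in> basis_sets \<phi>"
  shows "\<exists>!v. v \<in> relations \<phi> \<and> x - v \<in> span ((\<lambda>i. axis i 1) ` K)"
proof -
  define L where "L = (\<lambda>y::real^'n. \<Sum>i\<in>UNIV. y $ i *\<^sub>R \<phi> i)"
  have lin: "linear L"
    unfolding L_def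
    by (intro linearI) (simp_all add: scaleR_add_left sum.distrib scaleR_sum_right)
  have Lax: "L (axis i 1) = \<phi> i" for i
    by (simp add: L_def axis_def if_distrib [of "\<lambda>c. c *\<^sub>R _"] cong: if_cong)
  have inj: "inj_on (\<lambda>i. axis i 1 :: real^'n) K"
    by (auto simp: inj_on_def axis_eq_axis)
  let ?E = "(\<lambda>i. axis i 1 :: real^'n) ` K"
  have img: "L ` ?E = \<phi> ` K"
    by (simp add: image_image Lax)
  have "inj_on L ?E"
    using K by (auto simp: inj_on_def basis_sets_def Lax)
  then have injL: "inj_on L (span ?E)"
    using linear_inj_on_span_independent_image [OF lin, of ?E] K img
    by (simp add: basis_sets_def)
  have "L x \<in> L ` span ?E"
    using K by (simp add: linear_span_image [OF lin, symmetric] img basis_sets_def)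
  then obtain w where w: "w \<in> span ?E" "L x = L w" by blast
  show ?thesis
  proof (rule ex1I [of _ "x - w"])
    show "x - w \<in> relations \<phi> \<and> x - (x - w) \<in> span ?E"
      using w linear_diff [OF lin, of x w] by (simp add: relations_def L_def)
  next
    fix v assume v: "v \<in> relations \<phi> \<and> x - v \<in> span ?E"
    then have "L v = 0" by (simp add: relations_def L_def)
    then have "L (x - v) = L w"
      using w linear_diff [OF lin, of x v] by simp
    then have "x - v = w"
      using injL v w by (auto dest: inj_onD)
    then show "v = x - w" by (simp add: algebra_simps)
  qed
qed

definition regular :: "('n::finite \<Rightarrow> 'a::real_vector) \<Rightarrow> (real ^ 'n \<Rightarrow> real) \<Rightarrow> bool" where
  "regular \<phi> \<beta> \<longleftrightarrow> (\<forall>K\<in>basis_sets \<phi>. \<forall>j\<in>- K. \<beta> (rho \<phi> K (axis j 1)) \<noteq> 0)"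

definition pos_part ::
    "('n::finite \<Rightarrow> 'a::real_vector) \<Rightarrow> (real ^ 'n \<Rightarrow> real) \<Rightarrow> 'n set \<Rightarrow> 'n set" where
  "pos_part \<phi> \<beta> K = {j \<in> - K. \<beta> (rho \<phi> K (axis j 1)) > 0}"

definition neg_part ::
    "('n::finite \<Rightarrow> 'a::real_vector) \<Rightarrow> (real ^ 'n \<Rightarrow> real) \<Rightarrow> 'n set \<Rightarrow> 'n set" where
  "neg_part \<phi> \<beta> K = {j \<in> - K. \<beta> (rho \<phi> K (axis j 1)) < 0}"

definition lawrence_varchenko ::
    "('n::finite \<Rightarrow> 'a::real_vector) \<Rightarrow> 'a set \<Rightarrow> (real ^ 'n \<Rightarrow> real) \<Rightarrow> 'n pq_poly" where
  "lawrence_varchenko \<phi> \<tau> \<beta> =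
     (\<Sum>K\<in>basis_sets_at \<phi> \<tau>.
        (-1) ^ card (neg_part \<phi> \<beta> K) * (\<Prod>i\<in>pos_part \<phi> \<beta> K. pvar i) *
        (\<Prod>i\<in>neg_part \<phi> \<beta> K. qvar i) * (\<Prod>i\<in>K. pvar i + qvar i))"

end

theory Submission
  imports Defs
begin

text \<open>Write \<open>s\<^sub>i = p\<^sub>i + q\<^sub>i\<close>. In the variables \<open>p\<close>, \<open>s\<close> the Brianchon-Gram function is
  already a signed sum of the monomials \<open>s\<^sub>I p\<^bsub>-I\<^esub>\<close>. Expanding \<open>q\<^sub>i = s\<^sub>i - p\<^sub>i\<close> for
  \<open>i\<close> in the negative part of a basis \<open>K\<close> turns the Lawrence-Varchenko function into
  the signed sum of \<open>s\<^sub>I p\<^bsub>-I\<^esub>\<close> over all \<open>I = K \<union> J\<close> with \<open>J\<close> contained in the negative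
  part of \<open>K\<close>, with sign \<open>(-1)\<^bsup>|J|\<^esup> = (-1)\<^bsup>|I| - dim F\<^esup>\<close>. So the identity says that every
  \<open>I\<close> whose cone contains the tope arises from exactly one such pair \<open>(K, J)\<close>, and that no other
  \<open>I\<close> arises.

  This is linear programming. For \<open>t\<close> in the tope, maximise \<open>\<beta>\<close> over the polyhedron of all
  \<open>x \<ge> 0\<close> supported in \<open>I\<close> with \<open>\<Sum>x\<^sub>i \<phi>\<^sub>i = t\<close>. The numbers
  \<open>\<beta> (rho \<phi> K (axis j 1))\<close> are the reduced costs of the basis \<open>K\<close>, so \<open>I - K\<close> lies in the
  negative part of \<open>K\<close> exactly if the vertex belonging to \<open>K\<close> passes the simplex optimality test.
  Salience makes the polyhedron bounded, so an optimal vertex exists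
  (\<open>optimal_basis_exists\<close>); \<open>t\<close> avoids the walls, so vertices are nondegenerate and correspond to
  bases (\<open>basis_support\<close>); and regularity excludes zero reduced costs, so the optimal basis is
  unique (\<open>optimal_basis_unique\<close>). Finally, a basic cone that meets the tope contains it
  (\<open>tope_subset_basic_cone\<close>), so the optimal basis at the single point \<open>t\<close> serves the whole tope.\<close>

section \<open>Relations and basic index sets\<close>

definition combination :: "('n::finite \<Rightarrow> 'a::real_vector) \<Rightarrow> real ^ 'n \<Rightarrow> 'a" where
  "combination \<phi> x = (\<Sum>i\<in>UNIV. x $ i *\<^sub>R \<phi> i)"

definition support :: "real ^ 'n \<Rightarrow> 'n set" where
  "support x = {i. x $ i \<noteq> 0}"

lemma support_subset_iff: "support x \<subseteq> K \<longleftrightarrow> (\<forall>i. i \<notin> K \<longrightarrow> x $ i = 0)"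
  by (auto simp: support_def)

lemma linear_combination: "linear (combination \<phi>)"
  unfolding combination_def
  by (intro linearI) (simp_all add: scaleR_add_left sum.distrib scaleR_sum_right)

lemma combination_axis: "combination \<phi> (axis i 1) = \<phi> i"
  by (simp add: combination_def axis_def if_distrib [of "\<lambda>c. c *\<^sub>R _"] cong: if_cong)

lemma combination_supported:
  assumes "support x \<subseteq> I"
  shows "combination \<phi> x = (\<Sum>i\<in>I. x $ i *\<^sub>R \<phi> i)"
  unfolding combination_def
  by (rule sum.mono_neutral_right) (use assms in \<open>auto simp: support_def\<close>)

lemma mem_relations_iff: "v \<in> relations \<phi> \<longleftrightarrow> combination \<phi> v = 0"
  by (simp add: relations_def combination_def)

lemma subspace_relations: "subspace (relations \<phi>)"
proof -
  have "relations \<phi> = {v. combination \<phi> v = 0}"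
    by (auto simp: mem_relations_iff)
  then show ?thesis
    using linear_subspace_kernel [OF linear_combination, of \<phi>] by simp
qed

lemma mem_span_axis_iff:
  fixes x :: "real ^ 'n::finite"
  shows "x \<in> span ((\<lambda>i. axis i 1) ` K) \<longleftrightarrow> support x \<subseteq> K"
proof
  have sub: "subspace {y::real^'n. support y \<subseteq> K}"
    by (auto simp: subspace_def support_def) force
  assume "x \<in> span ((\<lambda>i. axis i 1) ` K)"
  then have "x \<in> {y. support y \<subseteq> K}"
    by (rule span_induct) (use sub in \<open>auto simp: support_def axis_def split: if_splits\<close>)
  then show "support x \<subseteq> K" by simp
next
  assume K: "support x \<subseteq> K"
  have "x = (\<Sum>i\<in>K. x $ i *\<^sub>R axis i 1)"
  proof (rule vec_eq_iff [THEN iffD2], rule allI)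
    fix j
    show "x $ j = (\<Sum>i\<in>K. x $ i *\<^sub>R (axis i 1 :: real^'n)) $ j"
      using K by (auto simp: axis_def support_def if_distrib [of "\<lambda>c. _ * c"] cong: if_cong)
  qed
  moreover have "(\<Sum>i\<in>K. x $ i *\<^sub>R axis i 1) \<in> span ((\<lambda>i. axis i 1 :: real^'n) ` K)"
    by (intro span_sum span_scale span_base) auto
  ultimately show "x \<in> span ((\<lambda>i. axis i 1) ` K)" by simp
qed

text \<open>A family indexed by \<open>K\<close> is independent if and only if \<open>combination\<close> is injective on the vectors
  supported in \<open>K\<close>; this form also accounts for repeated vectors.\<close>

lemma basis_sets_iff:
  fixes \<phi> :: "'n::finite \<Rightarrow> 'a::real_vector"
  shows "K \<in> basis_sets \<phi> \<longleftrightarrow>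
    (\<forall>v\<in>relations \<phi>. support v \<subseteq> K \<longrightarrow> v = 0) \<and> span (\<phi> ` K) = UNIV"
proof -
  let ?E = "(\<lambda>i. axis i 1 :: real^'n) ` K"
  have img: "combination \<phi> ` ?E = \<phi> ` K"
    by (simp add: image_image combination_axis)
  have inj_iff: "inj_on (combination \<phi>) ?E \<longleftrightarrow> inj_on \<phi> K"
    by (auto simp: inj_on_def combination_axis axis_eq_axis)
  have "independent ?E"
    by (rule independent_mono [OF independent_Basis]) (auto simp: Basis_vec_def)
  then have "(inj_on \<phi> K \<and> independent (\<phi> ` K)) \<longleftrightarrow> inj_on (combination \<phi>) (span ?E)"
    using linear_inj_on_span_independent_image [OF linear_combination, of \<phi> ?E]
      linear_independent_injective_image [OF linear_combination, of ?E \<phi>]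
      inj_on_subset [of "combination \<phi>" "span ?E" ?E] span_superset [of ?E] img inj_iff
    by metis
  also have "\<dots> \<longleftrightarrow> (\<forall>v\<in>span ?E. combination \<phi> v = 0 \<longrightarrow> v = 0)"
    using linear_inj_on_iff_eq_0 [OF linear_combination subspace_span, of \<phi> ?E] by simp
  finally show ?thesis
    by (auto simp: basis_sets_def mem_span_axis_iff mem_relations_iff)
qed

lemma card_basis_sets:
  fixes \<phi> :: "'n::finite \<Rightarrow> 'a::euclidean_space"
  assumes "K \<in> basis_sets \<phi>"
  shows "card K = DIM('a)"
  using assms basis_card_eq_dim [of "\<phi> ` K" UNIV]
  by (simp add: basis_sets_def card_image)

lemma
  assumes "K \<in> basis_sets \<phi>"
  shows rho_in_relations: "rho \<phi> K x \<in> relations \<phi>"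
    and rho_outside: "i \<notin> K \<Longrightarrow> rho \<phi> K x $ i = x $ i"
proof -
  have "rho \<phi> K x \<in> relations \<phi> \<and> x - rho \<phi> K x \<in> span ((\<lambda>i. axis i 1) ` K)"
    unfolding rho_def by (rule theI' [OF ex1_rho [OF assms]])
  then show "rho \<phi> K x \<in> relations \<phi>" "i \<notin> K \<Longrightarrow> rho \<phi> K x $ i = x $ i"
    by (simp_all add: mem_span_axis_iff support_subset_iff)
qed

text \<open>The vectors \<open>rho \<phi> K (axis j 1)\<close> with \<open>j \<notin> K\<close> form a basis of the relations, and the
  coordinates of a relation in it are its own entries outside \<open>K\<close>. This makes the reduced costs
  control the variation of \<open>\<beta>\<close> over a fibre of \<open>combination \<phi>\<close>.\<close>

lemma linear_form_on_relations:
  assumes K: "K \<in> basis_sets \<phi>" and v: "v \<in> relations \<phi>" and \<beta>: "linear \<beta>"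
  shows "\<beta> v = (\<Sum>j\<in>-K. v $ j * \<beta> (rho \<phi> K (axis j 1)))"
proof -
  define w where "w = (\<Sum>j\<in>-K. v $ j *\<^sub>R rho \<phi> K (axis j 1))"
  have w: "w \<in> relations \<phi>"
    unfolding w_def
    by (intro subspace_sum subspace_scale subspace_relations rho_in_relations K)
  have "w $ i = v $ i" if "i \<notin> K" for i
  proof -
    show ?thesis
      using that by (simp add: w_def rho_outside [OF K] axis_def if_distrib [of "\<lambda>c. _ * c"]
          cong: if_cong)
  qed
  then have "support (v - w) \<subseteq> K"
    by (auto simp: support_def) force
  moreover have "v - w \<in> relations \<phi>"
    using v w by (intro subspace_diff subspace_relations)
  ultimately have "v = w"
    using K by (auto simp: basis_sets_iff)
  then have "\<beta> v = \<beta> (\<Sum>j\<in>-K. v $ j *\<^sub>R rho \<phi> K (axis j 1))"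
    by (simp add: w_def)
  then show ?thesis
    by (simp add: linear_sum [OF \<beta>] linear_cmul [OF \<beta>])
qed

section \<open>Feasible points\<close>

definition feasible :: "('n::finite \<Rightarrow> 'a::real_vector) \<Rightarrow> 'n set \<Rightarrow> 'a \<Rightarrow> (real ^ 'n) set" where
  "feasible \<phi> I t = {x. (\<forall>i. 0 \<le> x $ i) \<and> support x \<subseteq> I \<and> combination \<phi> x = t}"

lemma mem_generated_cone_iff:
  fixes \<phi> :: "'n::finite \<Rightarrow> 'a::real_vector"
  shows "t \<in> generated_cone \<phi> I \<longleftrightarrow> feasible \<phi> I t \<noteq> {}"
proof
  assume "t \<in> generated_cone \<phi> I"
  then obtain c where c: "t = (\<Sum>i\<in>I. c i *\<^sub>R \<phi> i)" "\<forall>i\<in>I. 0 \<le> c i"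
    by (auto simp: generated_cone_def)
  define x where "x = (\<chi> i. if i \<in> I then c i else 0)"
  have "support x \<subseteq> I" by (auto simp: support_def x_def split: if_splits)
  moreover have "combination \<phi> x = t"
    using combination_supported [OF calculation, of \<phi>] c by (simp add: x_def)
  ultimately have "x \<in> feasible \<phi> I t"
    using c by (auto simp: feasible_def x_def)
  then show "feasible \<phi> I t \<noteq> {}" by blast
next
  assume "feasible \<phi> I t \<noteq> {}"
  then obtain x where "x \<in> feasible \<phi> I t" by blast
  then show "t \<in> generated_cone \<phi> I"
    using combination_supported [of x I \<phi>]
    by (auto simp: generated_cone_def feasible_def)
qed

lemma generated_cone_mono:
  fixes \<phi> :: "'n::finite \<Rightarrow> 'a::real_vector"
  assumes "I \<subseteq> J" shows "generated_cone \<phi> I \<subseteq> generated_cone \<phi> J"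
proof
  fix t assume "t \<in> generated_cone \<phi> I"
  then show "t \<in> generated_cone \<phi> J"
    using assms unfolding mem_generated_cone_iff by (auto simp: feasible_def)
qed

text \<open>A nonnegative relation with positive entry at \<open>j\<close> writes \<open>- \<phi> j\<close> as a nonnegative
  combination, so the cone contains the whole line through \<open>\<phi> j\<close>. Salience thus bounds the
  feasible polyhedra: a nonzero relation leaves the nonnegative orthant.\<close>

lemma relation_has_negative_entry:
  assumes nz: "\<And>j. \<phi> j \<noteq> 0" and sal: "salient (generated_cone \<phi> UNIV)"
    and v: "v \<in> relations \<phi>" "v \<noteq> 0"
  shows "\<exists>i. v $ i < 0"
proof (rule ccontr)
  assume "\<not> ?thesis"
  then have nn: "0 \<le> v $ i" for i by (meson not_le)
  obtain j where "v $ j \<noteq> 0"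
    using v(2) by (auto simp: vec_eq_iff)
  then have j: "v $ j > 0" using nn [of j] by simp
  have "0 + s *\<^sub>R \<phi> j \<in> generated_cone \<phi> UNIV" for s
  proof -
    \<comment> \<open>Adding a large multiple of the relation makes the coefficient \<open>s\<close> at \<open>j\<close> nonnegative.\<close>
    define x where "x = s *\<^sub>R axis j 1 + (\<bar>s\<bar> / v $ j) *\<^sub>R v"
    have "combination \<phi> x = s *\<^sub>R \<phi> j"
      using v(1)
      by (simp add: x_def linear_add [OF linear_combination] linear_cmul [OF linear_combination]
          combination_axis mem_relations_iff)
    moreover have "0 \<le> x $ i" for i
      using j nn [of i] by (cases "i = j") (auto simp: x_def axis_def)
    ultimately have "x \<in> feasible \<phi> UNIV (0 + s *\<^sub>R \<phi> j)"
      by (auto simp: feasible_def)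
    then show ?thesis
      unfolding mem_generated_cone_iff by blast
  qed
  then show False
    using sal nz [of j] unfolding salient_def by blast
qed

text \<open>If some nonzero relation is supported in the support of \<open>x\<close>, move along it in the direction in
  which \<open>\<beta>\<close> does not decrease. Some coordinate decreases, so a first one reaches \<open>0\<close>, and the
  support has shrunk. Iterating this reaches a vertex; for the mere existence of \<open>y\<close> this is
  Caratheodory's theorem for cones.\<close>

lemma improve_to_vertex:
  fixes \<phi> :: "'n::finite \<Rightarrow> 'a::real_vector"
  assumes nz: "\<And>j. \<phi> j \<noteq> 0" and sal: "salient (generated_cone \<phi> UNIV)" and \<beta>: "linear \<beta>"
    and "x \<in> feasible \<phi> I t"
  shows "\<exists>y\<in>feasible \<phi> I t. (\<beta> x :: real) \<le> \<beta> y \<and>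
           (\<forall>v\<in>relations \<phi>. support v \<subseteq> support y \<longrightarrow> v = 0)"
  using assms(4)
proof (induction "card (support x)" arbitrary: x rule: less_induct)
  case less
  note x = less.prems
  show ?case
  proof (cases "\<forall>v\<in>relations \<phi>. support v \<subseteq> support x \<longrightarrow> v = 0")
    case True
    with x show ?thesis by blast
  next
    case False
    then obtain u where u: "u \<in> relations \<phi>" "support u \<subseteq> support x" "u \<noteq> 0" by blast
    define v where "v = (if 0 \<le> \<beta> u then u else - u)"
    have v: "v \<in> relations \<phi>" "support v \<subseteq> support x" "v \<noteq> 0" "0 \<le> \<beta> v"
      using u subspace_neg [OF subspace_relations u(1)] linear_neg [OF \<beta>, of u]
      by (auto simp: v_def support_def)
    define A where "A = {i. v $ i < 0}"
    have "A \<noteq> {}"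
      using relation_has_negative_entry [OF nz sal v(1) v(3)] by (simp add: A_def)
    define r where "r i = x $ i / - v $ i" for i
    obtain k where k: "k \<in> A" "\<And>i. i \<in> A \<Longrightarrow> r k \<le> r i"
      using ex_is_arg_min_if_finite [OF finite [of A] \<open>A \<noteq> {}\<close>, of r]
      by (auto simp: is_arg_min_def not_less)
    have x0: "0 \<le> x $ i" for i using x by (simp add: feasible_def)
    have r0: "0 \<le> r k"
      using k(1) x0 [of k] by (auto simp: r_def A_def field_simps)
    define y where "y = x + r k *\<^sub>R v"
    have y0: "0 \<le> y $ i" for i
    proof (cases "i \<in> A")
      case True
      with k(2) [OF True] show ?thesis
        by (simp add: y_def r_def A_def field_simps)
    next
      case False
      then show ?thesis
        using r0 x0 [of i] by (simp add: y_def A_def not_less)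
    qed
    have "support y \<subseteq> support x"
      using v(2) by (auto simp: support_def y_def)
    moreover have "k \<in> support x" "k \<notin> support y"
      using k(1) v(2) by (fastforce simp: support_def y_def r_def A_def)+
    ultimately have ss: "support y \<subset> support x" by blast
    then have "card (support y) < card (support x)"
      by (simp add: psubset_card_mono)
    moreover have "y \<in> feasible \<phi> I t"
      using x y0 ss v(1)
      by (auto simp: feasible_def y_def mem_relations_iff linear_add [OF linear_combination]
          linear_cmul [OF linear_combination])
    ultimately obtain z where z: "z \<in> feasible \<phi> I t" "\<beta> y \<le> \<beta> z"
      "\<forall>w\<in>relations \<phi>. support w \<subseteq> support z \<longrightarrow> w = 0"
      using less.hyps by blast
    have "\<beta> x \<le> \<beta> y"
      using r0 v(4) by (simp add: y_def linear_add [OF \<beta>] linear_cmul [OF \<beta>])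
    with z show ?thesis by (meson order_trans)
  qed
qed

section \<open>Topes and walls\<close>

text \<open>A subspace spanned by vectors \<open>\<phi> i\<close> that is not everything lies in a wall: complete a basis
  of it inside \<open>range \<phi>\<close> to a basis of the space and drop all but \<open>DIM('a) - 1\<close> vectors.\<close>

lemma span_support_of_generic:
  fixes \<phi> :: "'n::finite \<Rightarrow> 'a::euclidean_space"
  assumes gen: "span (range \<phi>) = UNIV" and t: "t \<notin> \<Union> (walls \<phi>)"
    and x: "combination \<phi> x = t"
  shows "span (\<phi> ` support x) = UNIV"
proof (rule ccontr)
  assume not_full: "span (\<phi> ` support x) \<noteq> UNIV"
  obtain B where B: "B \<subseteq> \<phi> ` support x" "independent B" "\<phi> ` support x \<subseteq> span B"
    by (meson maximal_independent_subset)
  obtain C where C: "B \<subseteq> C" "C \<subseteq> range \<phi>" "independent C" "range \<phi> \<subseteq> span C"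
    using maximal_independent_subset_extend [of B "range \<phi>"] B by blast
  have spanB: "span B = span (\<phi> ` support x)"
    using B by (metis span_mono span_span subset_antisym span_minimal subspace_span)
  have "span C = UNIV"
    using C(4) gen by (metis span_minimal subspace_span top.extremum_uniqueI)
  then have cardC: "card C = DIM('a)"
    using C(3) by (metis dim_UNIV dim_span_eq_card_independent)
  have "B \<noteq> C"
    using spanB \<open>span C = UNIV\<close> not_full by auto
  then have "card B < card C"
    using C(1,3) by (simp add: psubset_card_mono finiteI_independent psubset_eq)
  then have "card B \<le> DIM('a) - 1" "DIM('a) - 1 \<le> card C"
    using cardC by linarith+
  then obtain D where D: "B \<subseteq> D" "D \<subseteq> C" "card D = DIM('a) - 1"
    using exists_subset_between [of B _ C] C(1) finiteI_independent [OF C(3)] by blast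
  then have "D \<subseteq> range \<phi>" "independent D"
    using C independent_mono by blast+
  then have "span D \<in> walls \<phi>"
    using D(3) unfolding walls_def by blast
  moreover have "t \<in> span (\<phi> ` support x)"
    unfolding x [symmetric] combination_supported [OF subset_refl]
    by (intro span_sum span_scale span_base) simp
  then have "t \<in> span D"
    using spanB span_mono [OF D(1)] by auto
  ultimately show False using t by blast
qed

lemma basis_support:
  fixes \<phi> :: "'n::finite \<Rightarrow> 'a::euclidean_space"
  assumes "span (range \<phi>) = UNIV" "t \<notin> \<Union> (walls \<phi>)" "combination \<phi> x = t"
    and "\<forall>v\<in>relations \<phi>. support v \<subseteq> support x \<longrightarrow> v = 0"
  shows "support x \<in> basis_sets \<phi>"
  using span_support_of_generic [OF assms(1-3)] assms(4) by (simp add: basis_sets_iff)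

text \<open>A basis has no proper generating subset, so a point off the walls has no vanishing coordinate
  in a basis.\<close>

lemma basis_support_eq:
  fixes \<phi> :: "'n::finite \<Rightarrow> 'a::euclidean_space"
  assumes gen: "span (range \<phi>) = UNIV" and t: "t \<notin> \<Union> (walls \<phi>)"
    and x: "combination \<phi> x = t" and K: "K \<in> basis_sets \<phi>" "support x \<subseteq> K"
  shows "support x = K"
proof -
  have "support x \<in> basis_sets \<phi>"
    using basis_support [OF gen t x] K by (auto simp: basis_sets_iff)
  then have "card (support x) = card K"
    using K(1) by (simp add: card_basis_sets)
  then show ?thesis
    using K(2) by (simp add: card_subset_eq)
qed

text \<open>Each coordinate with respect to the basis \<open>K\<close> is a linear form that vanishes only on a wall,
  hence has constant sign on the connected set \<open>\<tau>\<close>.\<close>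

lemma tope_subset_basic_cone:
  fixes \<phi> :: "'n::finite \<Rightarrow> 'a::euclidean_space"
  assumes gen: "span (range \<phi>) = UNIV" and \<tau>: "\<tau> \<in> topes \<phi>"
    and K: "K \<in> basis_sets \<phi>" and s: "s \<in> \<tau>" "s \<in> generated_cone \<phi> K"
  shows "\<tau> \<subseteq> generated_cone \<phi> K"
proof
  fix t assume t: "t \<in> \<tau>"
  have conn: "connected \<tau>" and "\<tau> \<subseteq> - \<Union> (walls \<phi>)"
    using \<tau> in_components_connected in_components_subset unfolding topes_def by blast+
  then have off: "z \<notin> \<Union> (walls \<phi>)" if "z \<in> \<tau>" for z
    using that by blast
  have "t \<in> span (\<phi> ` K)" using K by (simp add: basis_sets_def)
  then have "t \<in> combination \<phi> ` span ((\<lambda>i. axis i 1) ` K)"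
    by (simp add: linear_span_image [OF linear_combination, symmetric] image_image
        combination_axis)
  then obtain y where y: "combination \<phi> y = t" "support y \<subseteq> K"
    by (auto simp: mem_span_axis_iff)
  obtain x where x: "\<And>i. 0 \<le> x $ i" "support x \<subseteq> K" "combination \<phi> x = s"
    using s(2) unfolding mem_generated_cone_iff by (auto simp: feasible_def)
  have "0 \<le> y $ k" for k
  proof (cases "k \<in> K")
    case False
    then show ?thesis using y by (simp add: support_subset_iff)
  next
    case kK: True
    obtain f :: "'a \<Rightarrow> real" where lf: "linear f"
      and f: "\<forall>b\<in>\<phi> ` K. f b = (if b = \<phi> k then 1 else 0)"
      using linear_independent_extend [of "\<phi> ` K" "\<lambda>b. if b = \<phi> k then 1 else 0"] K
      unfolding basis_sets_def by blast
    have coord: "f (combination \<phi> z) = z $ k" if "support z \<subseteq> K" for z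
    proof -
      have "f (combination \<phi> z) = (\<Sum>i\<in>K. z $ i * f (\<phi> i))"
        using combination_supported [OF that, of \<phi>]
        by (simp add: linear_sum [OF lf] linear_cmul [OF lf])
      also have "\<dots> = (\<Sum>i\<in>K. if i = k then z $ i else 0)"
        using f K kK by (intro sum.cong) (auto simp: basis_sets_def inj_on_eq_iff)
      finally show ?thesis using kK by simp
    qed
    have nz: "f z \<noteq> 0" if "z \<in> \<tau>" for z
    proof -
      have "z \<in> combination \<phi> ` span ((\<lambda>i. axis i 1) ` K)"
        using K by (simp add: linear_span_image [OF linear_combination, symmetric] image_image
            combination_axis basis_sets_def)
      then obtain w where w: "combination \<phi> w = z" "support w \<subseteq> K"
        by (auto simp: mem_span_axis_iff)
      then have "support w = K"
        using basis_support_eq [OF gen off [OF that] _ K] by blast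
      then show ?thesis using coord [of w] w kK by (auto simp: support_def)
    qed
    have "connected (f ` \<tau>)"
      using conn lf by (intro connected_continuous_image linear_continuous_on)
        (auto simp: linear_conv_bounded_linear)
    moreover have "0 \<le> f s" using coord [of x] x by simp
    ultimately have "0 \<in> f ` \<tau>" if "f t \<le> 0"
      using that s(1) t connectedD_interval [of "f ` \<tau>" "f t" "f s" 0] by blast
    then have "0 \<le> f t" using nz by force
    then show ?thesis using coord [of y] y by simp
  qed
  then show "t \<in> generated_cone \<phi> K"
    using y unfolding mem_generated_cone_iff by (auto simp: feasible_def)
qed

section \<open>The optimal basis\<close>

text \<open>A best one among the finitely many vertices passes the optimality test: a positive reduced
  cost at \<open>j\<close> would give a strictly better feasible point, and then, by \<open>improve_to_vertex\<close>,
  a strictly better vertex.\<close>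

lemma optimal_basis_exists:
  fixes \<phi> :: "'n::finite \<Rightarrow> 'a::euclidean_space"
  assumes nz: "\<And>j. \<phi> j \<noteq> 0" and gen: "span (range \<phi>) = UNIV"
    and sal: "salient (generated_cone \<phi> UNIV)"
    and \<beta>: "linear \<beta>" and reg: "regular \<phi> \<beta>"
    and t: "t \<notin> \<Union> (walls \<phi>)" and tI: "t \<in> generated_cone \<phi> I"
  shows "\<exists>K\<in>basis_sets \<phi>. t \<in> generated_cone \<phi> K \<and> K \<subseteq> I \<and> I - K \<subseteq> neg_part \<phi> \<beta> K"
proof -
  define X where "X = {x \<in> feasible \<phi> I t. support x \<in> basis_sets \<phi>}"
  have improve: "\<exists>y\<in>X. \<beta> x \<le> \<beta> y" if x: "x \<in> feasible \<phi> I t" for x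
  proof -
    obtain y where y: "y \<in> feasible \<phi> I t" "\<beta> x \<le> \<beta> y"
      "\<forall>v\<in>relations \<phi>. support v \<subseteq> support y \<longrightarrow> v = 0"
      using improve_to_vertex [OF nz sal \<beta> x] by blast
    moreover have "support y \<in> basis_sets \<phi>"
      using basis_support [OF gen t _ y(3)] y(1) by (simp add: feasible_def)
    ultimately show ?thesis by (auto simp: X_def)
  qed
  have "inj_on support X"
  proof (rule inj_onI)
    fix x y assume xy: "x \<in> X" "y \<in> X" "support x = support y"
    have "x - y \<in> relations \<phi>"
      using xy by (simp add: X_def feasible_def mem_relations_iff linear_diff [OF linear_combination])
    moreover have "support (x - y) \<subseteq> support x"
      using xy(3) by (auto simp: support_def set_eq_iff)
    ultimately show "x = y"
      using xy(1) by (auto simp: X_def basis_sets_iff)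
  qed
  then have "finite X"
    by (rule finite_imageD [rotated]) simp
  moreover have "X \<noteq> {}"
    using tI improve unfolding mem_generated_cone_iff by blast
  ultimately obtain x where x: "x \<in> X" and best: "\<And>y. y \<in> X \<Longrightarrow> \<beta> y \<le> \<beta> x"
    using ex_is_arg_min_if_finite [of X "\<lambda>y. - \<beta> y"] by (auto simp: is_arg_min_def not_less)
  define K where "K = support x"
  have K: "K \<in> basis_sets \<phi>" and xf: "x \<in> feasible \<phi> I t"
    using x by (auto simp: X_def K_def)
  have "I - K \<subseteq> neg_part \<phi> \<beta> K"
  proof
    fix j assume j: "j \<in> I - K"
    define v where "v = rho \<phi> K (axis j 1)"
    have "\<not> 0 < \<beta> v"
    proof
      assume pos: "0 < \<beta> v"
      have xK: "0 < x $ i" if "i \<in> K" for i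
        using that xf by (auto simp: K_def support_def feasible_def less_le)
      \<comment> \<open>A step of length \<open>e\<close> along \<open>v\<close> keeps the coordinates in \<open>K\<close> nonnegative. The first \<open>1\<close>
        makes the set nonempty, the second avoids division by zero.\<close>
      define e where "e = Min (insert 1 ((\<lambda>i. x $ i / (1 + \<bar>v $ i\<bar>)) ` K))"
      have e: "0 < e"
        unfolding e_def using xK by (subst Min_gr_iff) (auto intro!: divide_pos_pos add_pos_nonneg)
      define y where "y = x + e *\<^sub>R v"
      have v_out: "v $ i = (if i = j then 1 else 0)" if "i \<notin> K" for i
        using that by (simp add: v_def rho_outside [OF K] axis_def)
      have "0 \<le> y $ i" for i
      proof (cases "i \<in> K")
        case True
        then have "e \<le> x $ i / (1 + \<bar>v $ i\<bar>)"
          by (auto simp: e_def intro!: Min_le)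
        then have "e * (1 + \<bar>v $ i\<bar>) \<le> x $ i"
          by (subst (asm) pos_le_divide_eq) auto
        then have "e + e * \<bar>v $ i\<bar> \<le> x $ i" by (simp add: algebra_simps)
        moreover have "\<bar>e * v $ i\<bar> = e * \<bar>v $ i\<bar>" using e by (simp add: abs_mult)
        ultimately show ?thesis using e by (simp add: y_def)
      next
        case False
        then show ?thesis
          using e xf by (auto simp: y_def v_out feasible_def)
      qed
      moreover have "support y \<subseteq> I"
      proof
        fix i assume i: "i \<in> support y"
        show "i \<in> I"
        proof (rule ccontr)
          assume "i \<notin> I"
          then have "x $ i = 0" "i \<notin> K" "i \<noteq> j"
            using xf j by (auto simp: feasible_def support_def K_def)
          then show False using i by (simp add: support_def y_def v_out)
        qed
      qed
      moreover have "combination \<phi> y = t"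
        using xf rho_in_relations [OF K, of "axis j 1"]
        by (simp add: y_def v_def feasible_def mem_relations_iff
            linear_add [OF linear_combination] linear_cmul [OF linear_combination])
      ultimately have "y \<in> feasible \<phi> I t" by (simp add: feasible_def)
      then obtain z where "z \<in> X" "\<beta> y \<le> \<beta> z" using improve by blast
      moreover have "\<beta> x < \<beta> y"
        using e pos by (simp add: y_def linear_add [OF \<beta>] linear_cmul [OF \<beta>])
      ultimately show False using best [of z] by simp
    qed
    moreover have "\<beta> v \<noteq> 0"
      using reg K j by (auto simp: regular_def v_def)
    ultimately show "j \<in> neg_part \<phi> \<beta> K"
      using j by (auto simp: neg_part_def v_def)
  qed
  moreover have "t \<in> generated_cone \<phi> K" "K \<subseteq> I"
    using xf unfolding mem_generated_cone_iff by (auto simp: feasible_def K_def)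
  ultimately show ?thesis using K by blast
qed

text \<open>By \<open>linear_form_on_relations\<close>, \<open>\<beta> y - \<beta> x\<close> is the sum of the entries of \<open>y\<close> outside \<open>K\<close>
  weighted with the reduced costs of \<open>K\<close>, which are negative on \<open>I - K\<close>. So \<open>y\<close> pays for every
  index outside \<open>K\<close> that it uses.\<close>

lemma optimal_vertex_beats:
  fixes \<phi> :: "'n::finite \<Rightarrow> 'a::real_vector"
  assumes \<beta>: "linear \<beta>" and K: "K \<in> basis_sets \<phi>" "I - K \<subseteq> neg_part \<phi> \<beta> K"
    and x: "x \<in> feasible \<phi> K t" and y: "y \<in> feasible \<phi> I t"
  shows "\<beta> y \<le> \<beta> x" and "\<not> support y \<subseteq> K \<Longrightarrow> \<beta> y < \<beta> x"
proof -
  have rel: "y - x \<in> relations \<phi>"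
    using x y by (simp add: feasible_def mem_relations_iff linear_diff [OF linear_combination])
  have "\<beta> y - \<beta> x = \<beta> (y - x)"
    by (simp add: linear_diff [OF \<beta>])
  also have "\<dots> = (\<Sum>j\<in>-K. (y - x) $ j * \<beta> (rho \<phi> K (axis j 1)))"
    by (rule linear_form_on_relations [OF K(1) rel \<beta>])
  also have "\<dots> = (\<Sum>j\<in>-K. y $ j * \<beta> (rho \<phi> K (axis j 1)))"
    using x by (intro sum.cong) (auto simp: feasible_def support_def)
  finally have diff: "\<beta> y - \<beta> x = (\<Sum>j\<in>-K. y $ j * \<beta> (rho \<phi> K (axis j 1)))" .
  have term_neg: "y $ j * \<beta> (rho \<phi> K (axis j 1)) < 0" if "j \<in> support y - K" for j
  proof -
    have "j \<in> neg_part \<phi> \<beta> K" using that y K(2) by (auto simp: feasible_def)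
    moreover have "0 < y $ j" using that y by (auto simp: feasible_def support_def less_le)
    ultimately show ?thesis by (simp add: neg_part_def mult_pos_neg)
  qed
  then have term_le: "y $ j * \<beta> (rho \<phi> K (axis j 1)) \<le> 0" if "j \<in> -K" for j
    using that by (cases "j \<in> support y") (auto simp: support_def intro: less_imp_le)
  show "\<beta> y \<le> \<beta> x"
    using diff sum_nonpos [of "-K" "\<lambda>j. y $ j * \<beta> (rho \<phi> K (axis j 1))"] term_le by simp
  assume "\<not> support y \<subseteq> K"
  then obtain j where "j \<in> support y - K" by blast
  then have "(\<Sum>j\<in>-K. y $ j * \<beta> (rho \<phi> K (axis j 1))) < (\<Sum>j\<in>-K. 0)"
    using term_le term_neg by (intro sum_strict_mono_ex1) auto
  then show "\<beta> y < \<beta> x" using diff by simp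
qed

text \<open>Two optimal vertices have the same value, so neither uses an index outside the basis of the
  other; off the walls the support of a vertex is its whole basis.\<close>

lemma optimal_basis_unique:
  fixes \<phi> :: "'n::finite \<Rightarrow> 'a::euclidean_space"
  assumes gen: "span (range \<phi>) = UNIV" and \<beta>: "linear \<beta>" and t: "t \<notin> \<Union> (walls \<phi>)"
    and K: "K \<in> basis_sets \<phi>" "t \<in> generated_cone \<phi> K" "K \<subseteq> I" "I - K \<subseteq> neg_part \<phi> \<beta> K"
    and L: "L \<in> basis_sets \<phi>" "t \<in> generated_cone \<phi> L" "L \<subseteq> I" "I - L \<subseteq> neg_part \<phi> \<beta> L"
  shows "K = L"
proof -
  obtain x y where x: "x \<in> feasible \<phi> K t" and y: "y \<in> feasible \<phi> L t"
    using K(2) L(2) unfolding mem_generated_cone_iff by blast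
  have sx: "support x = K" and sy: "support y = L"
    using x y basis_support_eq [OF gen t _ K(1)] basis_support_eq [OF gen t _ L(1)]
    by (auto simp: feasible_def)
  have xI: "x \<in> feasible \<phi> I t" and yI: "y \<in> feasible \<phi> I t"
    using x y K(3) L(3) by (auto simp: feasible_def)
  have "\<beta> y \<le> \<beta> x" "\<beta> x \<le> \<beta> y"
    using optimal_vertex_beats(1) [OF \<beta> K(1,4) x yI] optimal_vertex_beats(1) [OF \<beta> L(1,4) y xI]
    by auto
  then have "support y \<subseteq> K" "support x \<subseteq> L"
    using optimal_vertex_beats(2) [OF \<beta> K(1,4) x yI] optimal_vertex_beats(2) [OF \<beta> L(1,4) y xI]
    by fastforce+
  then show ?thesis using sx sy by auto
qed

text \<open>The combinatorial heart of the identity, matching the monomials of the two sides. The inverse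
  sends \<open>I\<close> to its optimal basis \<open>K\<close> and \<open>J = I - K\<close>.\<close>

lemma bij_betw_generating_sets_at:
  fixes \<phi> :: "'n::finite \<Rightarrow> 'a::euclidean_space"
  assumes nz: "\<And>j. \<phi> j \<noteq> 0" and gen: "span (range \<phi>) = UNIV"
    and sal: "salient (generated_cone \<phi> UNIV)" and \<tau>: "\<tau> \<in> topes \<phi>"
    and \<beta>: "linear \<beta>" and reg: "regular \<phi> \<beta>"
  shows "bij_betw (\<lambda>(K, J). K \<union> J)
    (SIGMA K:basis_sets_at \<phi> \<tau>. Pow (neg_part \<phi> \<beta> K)) (generating_sets_at \<phi> \<tau>)"
proof -
  obtain t where t\<tau>: "t \<in> \<tau>"
    using \<tau> in_components_nonempty by (auto simp: topes_def)
  have t: "t \<notin> \<Union> (walls \<phi>)"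
    using \<tau> t\<tau> in_components_subset by (fastforce simp: topes_def)
  let ?S = "SIGMA K:basis_sets_at \<phi> \<tau>. Pow (neg_part \<phi> \<beta> K)"
  have disj: "K \<inter> J = {}" if "J \<subseteq> neg_part \<phi> \<beta> K" for K J
    using that by (auto simp: neg_part_def)
  show ?thesis
  proof (rule bij_betw_imageI)
    show "inj_on (\<lambda>(K, J). K \<union> J) ?S"
    proof (rule inj_onI, clarify)
      fix K J L M
      assume K: "K \<in> basis_sets_at \<phi> \<tau>" and J: "J \<subseteq> neg_part \<phi> \<beta> K"
        and L: "L \<in> basis_sets_at \<phi> \<tau>" and M: "M \<subseteq> neg_part \<phi> \<beta> L"
        and eq: "K \<union> J = L \<union> M"
      have "K = L"
      proof (rule optimal_basis_unique [OF gen \<beta> t, where I = "K \<union> J"])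
        show "K \<union> J - K \<subseteq> neg_part \<phi> \<beta> K" "K \<subseteq> K \<union> J" using J by auto
        show "K \<union> J - L \<subseteq> neg_part \<phi> \<beta> L" "L \<subseteq> K \<union> J" using M eq by auto
      qed (use K L t\<tau> in \<open>auto simp: basis_sets_at_def\<close>)
      moreover have "J = M"
        using calculation eq disj [OF J] disj [OF M] by blast
      ultimately show "K = L \<and> J = M" by simp
    qed
    show "(\<lambda>(K, J). K \<union> J) ` ?S = generating_sets_at \<phi> \<tau>"
    proof (intro equalityI subsetI)
      fix I assume "I \<in> (\<lambda>(K, J). K \<union> J) ` ?S"
      then obtain K J where KJ: "K \<in> basis_sets_at \<phi> \<tau>" "I = K \<union> J" by auto
      then have "\<tau> \<subseteq> generated_cone \<phi> I"
        using generated_cone_mono [of K I \<phi>] by (auto simp: basis_sets_at_def)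
      moreover have "span (\<phi> ` I) = UNIV"
        using KJ span_mono [of "\<phi> ` K" "\<phi> ` I"] by (auto simp: basis_sets_at_def basis_sets_def)
      ultimately show "I \<in> generating_sets_at \<phi> \<tau>"
        by (simp add: generating_sets_at_def generating_sets_def)
    next
      fix I assume "I \<in> generating_sets_at \<phi> \<tau>"
      then have "t \<in> generated_cone \<phi> I"
        using t\<tau> by (auto simp: generating_sets_at_def)
      from optimal_basis_exists [OF nz gen sal \<beta> reg t this]
      obtain K where K: "K \<in> basis_sets \<phi>" "t \<in> generated_cone \<phi> K" "K \<subseteq> I"
        "I - K \<subseteq> neg_part \<phi> \<beta> K" by blast
      then have "\<tau> \<subseteq> generated_cone \<phi> K"
        using tope_subset_basic_cone [OF gen \<tau>] t\<tau> by blast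
      then have "(K, I - K) \<in> ?S" using K by (auto simp: basis_sets_at_def)
      then show "I \<in> (\<lambda>(K, J). K \<union> J) ` ?S"
        using K(3) by (rule_tac image_eqI [of _ _ "(K, I - K)"]) auto
    qed
  qed
qed

section \<open>The polynomial identity\<close>

text \<open>Expansion of \<open>(-q)\<^sub>A = (p - (p + q))\<^sub>A\<close>.\<close>

lemma signed_prod_q_expand:
  fixes p q :: "'n \<Rightarrow> 'r::comm_ring_1"
  assumes "finite A"
  shows "(-1) ^ card A * (\<Prod>i\<in>A. q i) =
    (\<Sum>J\<in>Pow A. (-1) ^ card J * (\<Prod>i\<in>J. p i + q i) * (\<Prod>i\<in>A - J. p i))"
  using prod_diff_conv_sum [OF assms, of p "\<lambda>i. p i + q i"] by (simp add: prod_uminus)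

theorem theorem25:
  fixes \<phi> :: "'n::finite \<Rightarrow> 'a::euclidean_space"
    and \<tau> :: "'a set"
    and \<beta> :: "real ^ 'n \<Rightarrow> real"
  assumes "\<And>j. \<phi> j \<noteq> 0"
    and "span (range \<phi>) = UNIV"
    and "salient (generated_cone \<phi> UNIV)"
    and "\<tau> \<in> topes \<phi>"
    and "\<tau> \<subseteq> generated_cone \<phi> UNIV"
    and "linear \<beta>"
    and "regular \<phi> \<beta>"
  shows "lawrence_varchenko \<phi> \<tau> \<beta> = brianchon_gram \<phi> \<tau>"
proof -
  define s :: "'n \<Rightarrow> 'n pq_poly" where "s i = pvar i + qvar i" for i
  define m where "m I = (-1) ^ (card I - DIM('a)) * (\<Prod>i\<in>- I. pvar i) * (\<Prod>i\<in>I. s i)" for I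
  have expand: "(-1) ^ card (neg_part \<phi> \<beta> K) * (\<Prod>i\<in>pos_part \<phi> \<beta> K. pvar i) *
        (\<Prod>i\<in>neg_part \<phi> \<beta> K. qvar i) * (\<Prod>i\<in>K. s i) =
      (\<Sum>J\<in>Pow (neg_part \<phi> \<beta> K). m (K \<union> J))" if "K \<in> basis_sets_at \<phi> \<tau>" for K
  proof -
    let ?P = "pos_part \<phi> \<beta> K" and ?M = "neg_part \<phi> \<beta> K"
    have K: "K \<in> basis_sets \<phi>" using that by (simp add: basis_sets_at_def)
    have monomial: "(\<Prod>i\<in>?P. pvar i) * (\<Prod>i\<in>K. s i) *
        ((-1) ^ card J * (\<Prod>i\<in>J. s i) * (\<Prod>i\<in>?M - J. pvar i)) = m (K \<union> J)"
      if J: "J \<subseteq> ?M" for J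
    proof -
      have KJ: "K \<inter> J = {}" using J by (auto simp: neg_part_def)
      have compl: "- (K \<union> J) = ?P \<union> (?M - J)"
        \<comment> \<open>Regularity: every index outside \<open>K\<close> is positive or negative.\<close>
        using J K \<open>regular \<phi> \<beta>\<close>
        by (fastforce simp: neg_part_def pos_part_def regular_def neq_iff)
      have "(\<Prod>i\<in>- (K \<union> J). pvar i) = (\<Prod>i\<in>?P. pvar i) * (\<Prod>i\<in>?M - J. pvar i :: 'n pq_poly)"
        unfolding compl by (rule prod.union_disjoint) (auto simp: neg_part_def pos_part_def)
      moreover have "(\<Prod>i\<in>K \<union> J. s i) = (\<Prod>i\<in>K. s i) * (\<Prod>i\<in>J. s i)"
        using KJ by (intro prod.union_disjoint) auto
      moreover have "card (K \<union> J) - DIM('a) = card J"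
        using KJ card_basis_sets [OF K] by (simp add: card_Un_disjoint)
      ultimately show ?thesis by (simp add: m_def mult_ac)
    qed
    have "(-1) ^ card ?M * (\<Prod>i\<in>?P. pvar i) * (\<Prod>i\<in>?M. qvar i) * (\<Prod>i\<in>K. s i) =
        (\<Prod>i\<in>?P. pvar i) * (\<Prod>i\<in>K. s i) * ((-1) ^ card ?M * (\<Prod>i\<in>?M. qvar i))"
      by (simp add: mult_ac)
    also have "\<dots> = (\<Sum>J\<in>Pow ?M. (\<Prod>i\<in>?P. pvar i) * (\<Prod>i\<in>K. s i) *
        ((-1) ^ card J * (\<Prod>i\<in>J. s i) * (\<Prod>i\<in>?M - J. pvar i)))"
      unfolding s_def signed_prod_q_expand [OF finite, of ?M qvar pvar]
      by (rule sum_distrib_left)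
    also have "\<dots> = (\<Sum>J\<in>Pow ?M. m (K \<union> J))"
      using monomial by (intro sum.cong) auto
    finally show ?thesis .
  qed
  have "lawrence_varchenko \<phi> \<tau> \<beta> =
      (\<Sum>K\<in>basis_sets_at \<phi> \<tau>. \<Sum>J\<in>Pow (neg_part \<phi> \<beta> K). m (K \<union> J))"
    unfolding lawrence_varchenko_def s_def [symmetric] using expand by (rule sum.cong [OF refl])
  also have "\<dots> = (\<Sum>(K, J)\<in>(SIGMA K:basis_sets_at \<phi> \<tau>. Pow (neg_part \<phi> \<beta> K)). m (K \<union> J))"
    by (rule sum.Sigma) auto
  also have "\<dots> = (\<Sum>I\<in>generating_sets_at \<phi> \<tau>. m I)"
    using sum.reindex_bij_betw [OF bij_betw_generating_sets_at, OF assms(1-4,6,7), of m]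
    by (simp add: case_prod_unfold)
  also have "\<dots> = brianchon_gram \<phi> \<tau>"
    by (simp add: brianchon_gram_def m_def s_def)
  finally show ?thesis .
qed

end
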